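(* Let $r\ge 2$, let $w^{(1)},\dots,w^{(r)}$ be a perfect system of weights on $\mathbb R$, and let $\vec n=(n_1,\dots,n_r)\in\mathbb N^r$ be a multi-index with $n=|\vec n|=n_1+\dots+n_r\ge 1$. Then the type I linear form $Q_{\vec n}$ satisfies $$Q_{\vec n}(x)=\boldsymbol e_n^\top(\boldsymbol M^\top)^{-1}\boldsymbol q(x)=-\frac{1}{\det\boldsymbol M}\det\begin{pmatrix}\boldsymbol M&\boldsymbol e_n\\ \boldsymbol q(x)^\top&0\end{pmatrix},$$ where $\boldsymbol e_n=(0,\dots,0,1)^\top\in\mathbb R^n$.
   Context: Weights: $w^{(1)},\dots,w^{(r)}$ are densities (with respect to Lebesgue measure) of positive measures on $\mathbb R$ all of whose moments exist. $\mathbb N=\{0,1,2,\dots\}$. Type II polynomial: $P_{\vec n}$ is a monic polynomial of degree $n=|\vec n|$ with $\int_{\mathbb R}P_{\vec n}(x)x^k w^{(j)}(x)\,dx=0$ for $k=0,\dots,n_j-1$, $j=1,\dots,r$. Type I: a nonzero vector of polynomials $(A_1,\dots,A_r)$ with $\deg A_j\le n_j-1$ such that the linear form $Q_{\vec n}(x)=\sum_{j=1}^r A_j(x)w^{(j)}(x)$ satisfies $\int_{\mathbb R}Q_{\vec n}(x)x^k\,dx=0$ for $k=0,\dots,n-2$ and $=1$ for $k=n-1$. The system is perfect if for every (nonzero) multi-index in $\mathbb N^r$ the type I and type II objects exist and are unique. Reference orthogonal polynomials: $p_k$ is the monic polynomial of degree $k$ with $\int_{\mathbb R}p_k(x)p_m(x)w^{(1)}(x)\,dx=h_k\delta_{km}$.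 Vectors and matrices: $\boldsymbol p(x)=(p_0(x),\dots,p_{n-1}(x))^\top$; $\boldsymbol q(x)$ is the $n$-column vector obtained by stacking, for $j=1,\dots,r$ in this order, the blocks $(p_0(x)w^{(j)}(x),\dots,p_{n_j-1}(x)w^{(j)}(x))^\top$; $\boldsymbol M=\int_{\mathbb R}\boldsymbol p(s)\boldsymbol q(s)^\top ds$ (an $n\times n$ matrix). *)

theory Defs
  imports
    "HOL-Analysis.Equivalence_Lebesgue_Henstock_Integration"
    "HOL-Computational_Algebra.Polynomial"
    "Jordan_Normal_Form.Determinant"
    "Jordan_Normal_Form.Gauss_Jordan_Elimination"
begin

unbundle no inner_syntax and no vec_syntax

text \<open>
  The weights, the multi-index and the type I polynomials are lists indexed from 0: for a list
  \<open>ws\<close> of weights, \<open>r = length ws\<close> and the \<open>j\<close>-th weight (counted from 1) is \<open>ws ! (j - 1)\<close>.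
\<close>

text \<open>A density is only determined almost everywhere, hence the condition on the sign.\<close>

definition weight :: "(real \<Rightarrow> real) \<Rightarrow> bool" where
  "weight w \<longleftrightarrow> w \<in> borel_measurable lebesgue \<and> (AE x in lebesgue. 0 \<le> w x) \<and>
     (\<forall>k::nat. integrable lebesgue (\<lambda>x. x ^ k * w x))"

definition type_II :: "(real \<Rightarrow> real) list \<Rightarrow> nat list \<Rightarrow> real poly \<Rightarrow> bool" where
  "type_II ws ns P \<longleftrightarrow> lead_coeff P = 1 \<and> degree P = sum_list ns \<and>
     (\<forall>j < length ws. \<forall>k < ns ! j. (LINT x|lebesgue. poly P x * x ^ k * (ws ! j) x) = 0)"

definition linear_form :: "(real \<Rightarrow> real) list \<Rightarrow> real poly list \<Rightarrow> real \<Rightarrow> real" where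
  "linear_form ws As x = (\<Sum>j<length ws. poly (As ! j) x * (ws ! j) x)"

text \<open>
  The bound \<open>deg A\<^sub>j \<le> n\<^sub>j - 1\<close> is read with \<open>deg 0 = -\<infinity>\<close>; in particular \<open>A\<^sub>j = 0\<close> if \<open>n\<^sub>j = 0\<close>.
\<close>

definition type_I :: "(real \<Rightarrow> real) list \<Rightarrow> nat list \<Rightarrow> real poly list \<Rightarrow> bool" where
  "type_I ws ns As \<longleftrightarrow> length As = length ws \<and> (\<exists>j < length ws. As ! j \<noteq> 0) \<and>
     (\<forall>j < length ws. As ! j = 0 \<or> degree (As ! j) < ns ! j) \<and>
     (\<forall>k < sum_list ns - 1. (LINT x|lebesgue. linear_form ws As x * x ^ k) = 0) \<and>
     (LINT x|lebesgue. linear_form ws As x * x ^ (sum_list ns - 1)) = 1"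

definition perfect :: "(real \<Rightarrow> real) list \<Rightarrow> bool" where
  "perfect ws \<longleftrightarrow> (\<forall>ns. length ns = length ws \<and> sum_list ns \<noteq> 0 \<longrightarrow>
     (\<exists>!As. type_I ws ns As) \<and> (\<exists>!P. type_II ws ns P))"

definition monic_orthogonal :: "(real \<Rightarrow> real) \<Rightarrow> (nat \<Rightarrow> real poly) \<Rightarrow> bool" where
  "monic_orthogonal w p \<longleftrightarrow> (\<forall>k. lead_coeff (p k) = 1 \<and> degree (p k) = k) \<and>
     (\<exists>h. \<forall>k m. (LINT x|lebesgue. poly (p k) x * poly (p m) x * w x) = (if k = m then h k else 0))"

definition p_vec :: "(nat \<Rightarrow> real poly) \<Rightarrow> nat list \<Rightarrow> real \<Rightarrow> real vec" where
  "p_vec p ns x = vec (sum_list ns) (\<lambda>k. poly (p k) x)"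

definition q_vec ::
  "(nat \<Rightarrow> real poly) \<Rightarrow> (real \<Rightarrow> real) list \<Rightarrow> nat list \<Rightarrow> real \<Rightarrow> real vec" where
  "q_vec p ws ns x = vec_of_list
     (concat (map (\<lambda>(w, m). map (\<lambda>k. poly (p k) x * w x) [0..<m]) (zip ws ns)))"

definition M_mat ::
  "(nat \<Rightarrow> real poly) \<Rightarrow> (real \<Rightarrow> real) list \<Rightarrow> nat list \<Rightarrow> real mat" where
  "M_mat p ws ns = mat (sum_list ns) (sum_list ns)
     (\<lambda>(i, j). LINT s|lebesgue. p_vec p ns s $ i * q_vec p ws ns s $ j)"

text \<open>
  The inverse of an invertible matrix; \<open>mat_inverse\<close> is \<open>None\<close> on singular matrices, where the
  value below is unspecified.
\<close>

definition inv_mat :: "real mat \<Rightarrow> real mat" where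
  "inv_mat A = the (mat_inverse A)"

definition e_last :: "nat \<Rightarrow> real vec" where
  "e_last n = unit_vec n (n - 1)"

definition bordered_mat :: "real mat \<Rightarrow> real vec \<Rightarrow> real vec \<Rightarrow> real mat" where
  "bordered_mat A u v = four_block_mat
     A                             (mat_of_cols (dim_vec u) [u])
     (mat_of_rows (dim_vec v) [v]) (0\<^sub>m 1 1)"

end

theory Submission
  imports Defs
begin

text \<open>
  Expand each component of a type I vector in the basis \<open>p\<^sub>0, p\<^sub>1, \<dots>\<close>. With \<open>c\<close> the stacked vector of
  coefficients, the linear form is \<open>c \<bullet> q(x)\<close>, and the moment conditions become \<open>M c = e\<^sub>n\<close>, because
  \<open>p\<^sub>0, \<dots>, p\<^sub>n\<^sub>-\<^sub>1\<close> is a unitriangular change of basis away from the monomials. Uniqueness of the type I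
  vector then says that \<open>M\<close> has trivial kernel. The determinant formula is block elimination.
\<close>

subsection \<open>Bordered matrices\<close>

text \<open>Column elimination: the border column is the combination of the columns of
  \<open>A\<close> with coefficients \<open>c\<close>, so subtracting that combination clears it and
  leaves -(c \<bullet> v) in the corner.\<close>

lemma det_bordered_mat_mult:
  fixes A :: "real mat"
  assumes A: "A \<in> carrier_mat n n" and c: "c \<in> carrier_vec n" and v: "v \<in> carrier_vec n"
  shows "det (bordered_mat A (A *\<^sub>v c) v) = - det A * (c \<bullet> v)"
proof -
  let ?C = "mat_of_cols n [c]" and ?V = "mat_of_rows n [v]"
  \<comment> \<open>Right multiplication by \<open>?U\<close> is this column operation;
    \<open>?U\<close> is unitriangular and so has determinant 1.\<close>
  let ?U = "four_block_mat (1\<^sub>m n) (- ?C) (0\<^sub>m 1 n) (1\<^sub>m 1)"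
  let ?B = "bordered_mat A (A *\<^sub>v c) v"
  have "mat_of_cols n [A *\<^sub>v c] = A * ?C"
    using A c by (intro eq_matI) (auto simp: mat_of_cols_def scalar_prod_def)
  then have B: "?B = four_block_mat A (A * ?C) ?V (0\<^sub>m 1 1)"
    using A v by (simp add: bordered_mat_def)
  have "?B * ?U = four_block_mat (A * 1\<^sub>m n + A * ?C * 0\<^sub>m 1 n) (A * (- ?C) + A * ?C * 1\<^sub>m 1)
      (?V * 1\<^sub>m n + 0\<^sub>m 1 1 * 0\<^sub>m 1 n) (?V * (- ?C) + 0\<^sub>m 1 1 * 1\<^sub>m 1)"
    unfolding B using A by (intro mult_four_block_mat[where ?n1.0 = n and ?n2.0 = 1]) auto
  also have "A * 1\<^sub>m n + A * ?C * 0\<^sub>m 1 n = A"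
    using A by simp
  also have "A * (- ?C) + A * ?C * 1\<^sub>m 1 = 0\<^sub>m n 1"
    using A uminus_l_inv_mat[OF mult_carrier_mat[OF A mat_of_cols_carrier(1)], of "[c]"] by simp
  also have "?V * 1\<^sub>m n + 0\<^sub>m 1 1 * 0\<^sub>m 1 n = ?V"
    using v by (intro eq_matI) auto
  also have "?V * (- ?C) + 0\<^sub>m 1 1 * 1\<^sub>m 1 = mat 1 1 (\<lambda>_. - (c \<bullet> v))"
    using c v by (intro eq_matI)
      (auto simp: mat_of_cols_def mat_of_rows_def scalar_prod_def sum_negf mult.commute)
  finally have BU: "?B * ?U = four_block_mat A (0\<^sub>m n 1) ?V (mat 1 1 (\<lambda>_. - (c \<bullet> v)))" .
  have "det ?U = 1"
    by (subst det_four_block_mat_lower_left_zero[where n = n and m = 1]) auto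
  moreover have "?B \<in> carrier_mat (n + 1) (n + 1)" "?U \<in> carrier_mat (n + 1) (n + 1)"
    unfolding B using A by (auto intro!: four_block_carrier_mat)
  ultimately have "det ?B = det (?B * ?U)"
    by (simp add: det_mult)
  also have "\<dots> = det A * det (mat 1 1 (\<lambda>_. - (c \<bullet> v)))"
    unfolding BU using A v
    by (intro det_four_block_mat_upper_right_zero) auto
  finally show ?thesis
    by (simp add: det_single)
qed

lemma inv_mat_inverse:
  assumes A: "A \<in> carrier_mat n n" and "det A \<noteq> 0"
  shows "inv_mat A * A = 1\<^sub>m n" "A * inv_mat A = 1\<^sub>m n" "inv_mat A \<in> carrier_mat n n"
proof -
  \<comment> \<open>The last argument of \<open>ring_mat\<close> only fills the extension slot of
    the ring record; it must agree with the instance of \<open>mat_inverse(1)\<close> below.\<close>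
  have "A \<in> Units (ring_mat TYPE(real) n undefined)"
    using det_non_zero_imp_unit[OF assms] .
  then obtain B where "mat_inverse A = Some B"
    using mat_inverse(1)[OF A, where b = undefined] by (cases "mat_inverse A") auto
  with mat_inverse(2)[OF A]
  show "inv_mat A * A = 1\<^sub>m n" "A * inv_mat A = 1\<^sub>m n" "inv_mat A \<in> carrier_mat n n"
    by (auto simp: inv_mat_def)
qed

text \<open>Moving \<open>A\<close> across the scalar product turns it into its transpose, which
  cancels the inverse. It will be used with A c = e_n.\<close>

lemma scalar_prod_inv_mat_transpose:
  assumes A: "A \<in> carrier_mat n n" and "det A \<noteq> 0"
    and c: "c \<in> carrier_vec n" and v: "v \<in> carrier_vec n"
  shows "(A *\<^sub>v c) \<bullet> (inv_mat (transpose_mat A) *\<^sub>v v) = c \<bullet> v"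
proof -
  let ?B = "inv_mat (transpose_mat A)"
  have At: "transpose_mat A \<in> carrier_mat n n" "det (transpose_mat A) \<noteq> 0"
    using A \<open>det A \<noteq> 0\<close> by (auto simp: det_transpose)
  note B = inv_mat_inverse[OF At]
  have w: "?B *\<^sub>v v \<in> carrier_vec n"
    using B v by simp
  have "(A *\<^sub>v c) \<bullet> (?B *\<^sub>v v) = c \<bullet> (transpose_mat A *\<^sub>v (?B *\<^sub>v v))"
    using transpose_vec_mult_scalar[OF A c w] A c w At
    by (simp add: comm_scalar_prod[of _ n])
  also have "transpose_mat A *\<^sub>v (?B *\<^sub>v v) = v"
    using assoc_mult_mat_vec[OF At(1) B(3) v] B v by simp
  finally show ?thesis .
qed

subsection \<open>Polynomial bases with one element in each degree\<close>

lemma poly_basis_expansion: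
  fixes p :: "nat \<Rightarrow> 'a::field poly"
  assumes "\<And>k. p k \<noteq> 0" "\<And>k. degree (p k) = k" "A = 0 \<or> degree A < m"
  shows "\<exists>a. A = (\<Sum>k<m. smult (a k) (p k))"
  using assms(3)
proof (induction m arbitrary: A)
  case (Suc m)
  \<comment> \<open>This multiple of \<open>p m\<close> cancels the coefficient of x^m. Taking
    \<open>coeff A m\<close> instead of the leading coefficient covers \<open>A\<close> of lower
    degree, where b = 0.\<close>
  define b where "b = coeff A m / lead_coeff (p m)"
  define B where "B = A - smult b (p m)"
  have "coeff (p m) m \<noteq> 0"
    using assms(1,2)[of m] by (metis leading_coeff_0_iff)
  then have "coeff B m = 0"
    using assms(2)[of m] by (simp add: B_def b_def)
  moreover have "degree B \<le> m"
    unfolding B_def using Suc.prems assms(2)[of m] by (intro degree_diff_le) auto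
  \<comment> \<open>Since \<open>degree 0 = 0\<close>, the zero polynomial has to be a separate
    case: for m = 0 no degree is below m.\<close>
  ultimately have "B = 0 \<or> degree B < m"
    by (metis le_neq_implies_less leading_coeff_0_iff)
  then obtain a where "B = (\<Sum>k<m. smult (a k) (p k))"
    using Suc.IH by blast
  then have "A = (\<Sum>k<Suc m. smult ((a(m := b)) k) (p k))"
    by (simp add: B_def algebra_simps)
  then show ?case by blast
qed auto

lemma degree_poly_basis_sum:
  fixes p :: "nat \<Rightarrow> 'a::field poly"
  assumes "\<And>k. degree (p k) = k"
  shows "(\<Sum>k<m. smult (a k) (p k)) = 0 \<or> degree (\<Sum>k<m. smult (a k) (p k)) < m"
proof (cases m)
  case (Suc l)
  have "degree (\<Sum>k<m. smult (a k) (p k)) \<le> l"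
    using assms Suc by (intro degree_sum_le) (auto intro: order_trans[OF degree_smult_le])
  then show ?thesis using Suc by simp
qed simp

text \<open>Only the last summand reaches the top degree, so its coefficients agree; cancel it and
  descend.\<close>

lemma poly_basis_unique:
  fixes p :: "nat \<Rightarrow> 'a::field poly"
  assumes "\<And>k. p k \<noteq> 0" "\<And>k. degree (p k) = k"
    and "(\<Sum>k<m. smult (a k) (p k)) = (\<Sum>k<m. smult (b k) (p k))" "k < m"
  shows "a k = b k"
  using assms(3,4)
proof (induction m)
  case (Suc m)
  have low: "coeff (\<Sum>k<m. smult (c k) (p k)) m = 0" for c
    using degree_poly_basis_sum[of p c m] assms(2) by (auto simp: coeff_eq_0)
  have "coeff (p m) m \<noteq> 0"
    using assms(1,2)[of m] by (metis leading_coeff_0_iff)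
  moreover have "coeff (\<Sum>k<Suc m. smult (a k) (p k)) m = coeff (\<Sum>k<Suc m. smult (b k) (p k)) m"
    using Suc.prems by simp
  ultimately have "a m = b m"
    by (simp add: low)
  with Suc show ?case
    by (cases "k = m") auto
qed simp

subsection \<open>Stacked indices\<close>

text \<open>Position i of the stacked vector belongs to block j and basis index k. Listing the pairs
  (j, k) explicitly turns sums over positions into double sums over blocks.\<close>

definition stacked :: "nat list \<Rightarrow> (nat \<times> nat) list" where
  "stacked ns = concat (map (\<lambda>j. map (Pair j) [0..<ns ! j]) [0..<length ns])"

lemma length_stacked [simp]: "length (stacked ns) = sum_list ns"
  by (simp add: stacked_def length_concat o_def map_nth)

lemma set_stacked: "set (stacked ns) = (SIGMA j:{..<length ns}. {..<ns ! j})"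
  by (auto simp: stacked_def)

lemma distinct_stacked: "distinct (stacked ns)"
proof -
  \<comment> \<open>Generalised to any distinct list of block numbers, so that the induction removes
    one block at a time.\<close>
  have "distinct (concat (map (\<lambda>j. map (Pair j) [0..<ns ! j]) js))" if "distinct js" for js
    using that by (induction js) (auto simp: distinct_map inj_on_def)
  then show ?thesis by (simp add: stacked_def)
qed

lemma sum_stacked:
  "(\<Sum>i<sum_list ns. f (stacked ns ! i)) = (\<Sum>j<length ns. \<Sum>k<ns ! j. f (j, k))"
proof -
  have "(\<Sum>i<sum_list ns. f (stacked ns ! i)) = sum f (set (stacked ns))"
    using sum.reindex_bij_betw[OF bij_betw_nth[OF distinct_stacked refl refl]] by simp
  then show ?thesis by (simp add: set_stacked sum.Sigma)
qed

lemma q_vec_stacked: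
  assumes "length ns = length ws"
  shows "q_vec p ws ns x =
    vec (sum_list ns) (\<lambda>i. case stacked ns ! i of (j, k) \<Rightarrow> poly (p k) x * (ws ! j) x)"
proof -
  have "zip ws ns = map (\<lambda>j. (ws ! j, ns ! j)) [0..<length ns]"
    using assms by (intro nth_equalityI) auto
  then have "concat (map (\<lambda>(w, m). map (\<lambda>k. poly (p k) x * w x) [0..<m]) (zip ws ns))
      = map (\<lambda>(j, k). poly (p k) x * (ws ! j) x) (stacked ns)"
    by (simp add: stacked_def map_concat o_def)
  then show ?thesis
    unfolding q_vec_def by (intro eq_vecI) (auto simp: vec_of_list_index)
qed

subsection \<open>Linear forms and their coefficient vectors\<close>

text \<open>The coefficient system \<open>a\<close> is a total function, but only its values at
  pairs in \<open>stacked ns\<close> enter; systems are therefore compared through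
  \<open>stack_vec\<close>.\<close>

definition combination ::
  "(nat \<Rightarrow> real poly) \<Rightarrow> nat list \<Rightarrow> (nat \<times> nat \<Rightarrow> real) \<Rightarrow> real poly list" where
  "combination p ns a = map (\<lambda>j. \<Sum>k<ns ! j. smult (a (j, k)) (p k)) [0..<length ns]"

definition stack_vec :: "nat list \<Rightarrow> (nat \<times> nat \<Rightarrow> real) \<Rightarrow> real vec" where
  "stack_vec ns a = vec (sum_list ns) (\<lambda>i. a (stacked ns ! i))"

lemma stack_vec_carrier [simp]: "stack_vec ns a \<in> carrier_vec (sum_list ns)"
  by (simp add: stack_vec_def)

lemma stack_vec_surj:
  assumes "v \<in> carrier_vec (sum_list ns)"
  obtains a where "v = stack_vec ns a"
proof -
  \<comment> \<open>The coefficient at a pair is the entry of \<open>v\<close> at the position of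
    that pair, which is unique because \<open>stacked ns\<close> is distinct.\<close>
  let ?a = "\<lambda>jk. v $ (the_inv_into {..<sum_list ns} ((!) (stacked ns)) jk)"
  have "inj_on ((!) (stacked ns)) {..<sum_list ns}"
    using bij_betw_nth[OF distinct_stacked, of "{..<sum_list ns}" ns] by (auto simp: bij_betw_def)
  then have "v = stack_vec ns ?a"
    using assms by (intro eq_vecI) (auto simp: stack_vec_def the_inv_into_f_f)
  then show thesis by (rule that)
qed

lemma linear_form_combination:
  assumes "length ns = length ws"
  shows "linear_form ws (combination p ns a) x = stack_vec ns a \<bullet> q_vec p ws ns x"
proof -
  have "stack_vec ns a \<bullet> q_vec p ws ns x =
      (\<Sum>i<sum_list ns. (\<lambda>(j, k). a (j, k) * (poly (p k) x * (ws ! j) x)) (stacked ns ! i))"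
    using assms
    by (simp add: stack_vec_def q_vec_stacked scalar_prod_def atLeast0LessThan case_prod_beta)
  also have "\<dots> = linear_form ws (combination p ns a) x"
    unfolding sum_stacked using assms
    by (simp add: linear_form_def combination_def poly_sum sum_distrib_right mult.assoc)
  finally show ?thesis by simp
qed

section \<open>Integrability, the product of \<open>M\<close> with a coefficient vector, and moment
  conditions\<close>

lemma integrable_poly_weight:
  assumes "weight w"
  shows "integrable lebesgue (\<lambda>x. poly P x * w x)"
proof -
  have "(\<lambda>x. poly P x * w x) = (\<lambda>x. \<Sum>i\<le>degree P. coeff P i * (x ^ i * w x))"
    by (simp add: poly_altdef sum_distrib_right mult.assoc)
  then show ?thesis
    using assms by (simp add: weight_def)
qed

lemma integrable_poly_linear_form:
  assumes "\<forall>w \<in> set ws. weight w"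
  shows "integrable lebesgue (\<lambda>x. linear_form ws As x * poly P x)"
proof -
  \<comment> \<open>Absorbing \<open>P\<close> into each component leaves a sum of polynomials times
    weights.\<close>
  have "(\<lambda>x. linear_form ws As x * poly P x) =
      (\<lambda>x. \<Sum>j<length ws. poly (As ! j * P) x * (ws ! j) x)"
    by (simp add: linear_form_def sum_distrib_left mult_ac)
  then show ?thesis
    using assms by (auto simp del: poly_mult intro!: Bochner_Integration.integrable_sum integrable_poly_weight)
qed

text \<open>As M is the integral of p q^T, the product M c is the integral of p (q^T c), and q^T c
  is the linear form with coefficients c.\<close>

lemma M_mat_mult_stack_vec:
  assumes W: "\<forall>w \<in> set ws. weight w" and L: "length ns = length ws" and "i < sum_list ns"
  shows "(M_mat p ws ns *\<^sub>v stack_vec ns a) $ i =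
    (LINT x|lebesgue. linear_form ws (combination p ns a) x * poly (p i) x)"
proof -
  let ?n = "sum_list ns" and ?c = "stack_vec ns a"
  \<comment> \<open>Exchanging the finite sum with the integral needs each entry integrable; an
    entry is the integral of p_i p_k times a weight.\<close>
  have int: "integrable lebesgue (\<lambda>s. poly (p i) s * q_vec p ws ns s $ j)" if "j < ?n" for j
  proof -
    obtain l k where lk: "stacked ns ! j = (l, k)" by fastforce
    then have "l < length ws"
      using that L nth_mem[of j "stacked ns"] by (auto simp: set_stacked)
    moreover have "(\<lambda>s. poly (p i) s * q_vec p ws ns s $ j) =
        (\<lambda>s. poly (p i * p k) s * (ws ! l) s)"
      using that L lk by (simp add: q_vec_stacked mult_ac)
    ultimately show ?thesis
      using W using integrable_poly_weight[of "ws ! l" "p i * p k"] by simp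
  qed
  have "(M_mat p ws ns *\<^sub>v ?c) $ i =
      (\<Sum>j<?n. (LINT s|lebesgue. poly (p i) s * q_vec p ws ns s $ j) * ?c $ j)"
    using assms by (simp add: M_mat_def p_vec_def scalar_prod_def stack_vec_def atLeast0LessThan)
  also have "\<dots> = (LINT s|lebesgue. (\<Sum>j<?n. poly (p i) s * q_vec p ws ns s $ j * ?c $ j))"
    using int by (subst Bochner_Integration.integral_sum) auto
  also have "\<dots> = (LINT s|lebesgue. linear_form ws (combination p ns a) s * poly (p i) s)"
    using L by (intro Bochner_Integration.integral_cong refl)
      (simp add: linear_form_combination scalar_prod_def q_vec_stacked atLeast0LessThan
        sum_distrib_left mult_ac)
  finally show ?thesis .
qed

text \<open>Both sides say that the linear functional P \<mapsto> \<integral> f P vanishes in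
  degrees below n - 1 and sends a monic polynomial of degree n - 1 to 1. Monicity preserves the
  value 1, since two such polynomials differ by lower-degree terms.\<close>

lemma moments_iff_basis:
  fixes p :: "nat \<Rightarrow> real poly"
  assumes int: "\<And>P. integrable lebesgue (\<lambda>x. f x * poly P x)"
    and p: "\<And>k. lead_coeff (p k) = 1" "\<And>k. degree (p k) = k"
  shows "(\<forall>k<n - 1. (LINT x|lebesgue. f x * x ^ k) = 0) \<and> (LINT x|lebesgue. f x * x ^ (n - 1)) = 1
    \<longleftrightarrow> (\<forall>k<n - 1. (LINT x|lebesgue. f x * poly (p k) x) = 0)
      \<and> (LINT x|lebesgue. f x * poly (p (n - 1)) x) = 1"
proof -
  define \<Lambda> where "\<Lambda> P = (LINT x|lebesgue. f x * poly P x)" for P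
  have add: "\<Lambda> (P + R) = \<Lambda> P + \<Lambda> R" for P R
    using int by (simp add: \<Lambda>_def ring_distribs)
  have smult: "\<Lambda> (smult c P) = c * \<Lambda> P" for c P
    by (simp add: \<Lambda>_def mult.left_commute)
  have zero: "\<Lambda> 0 = 0"
    by (simp add: \<Lambda>_def)
  have sum: "\<Lambda> (\<Sum>k\<in>S. g k) = (\<Sum>k\<in>S. \<Lambda> (g k))" if "finite S" for S and g :: "nat \<Rightarrow> _"
    using that by (induction S rule: finite_induct) (auto simp: add zero)
  \<comment> \<open>Stated for an arbitrary basis \<open>b\<close>, to be applied to the monomials
    in one direction and to \<open>p\<close> in the other.\<close>
  have basis: "\<Lambda> P = 0"
    if b: "\<And>k. b k \<noteq> 0" "\<And>k. degree (b k) = k" and b0: "\<forall>k<m. \<Lambda> (b k) = 0"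
      and P: "P = 0 \<or> degree P < m" for b m P
  proof -
    obtain a where "P = (\<Sum>k<m. smult (a k) (b k))"
      using poly_basis_expansion[OF b P] by blast
    then show ?thesis using b0 by (simp add: sum smult)
  qed
  define m where "m = n - 1"
  let ?x = "monom (1::real)"
  have p0: "p k \<noteq> 0" for k
    using p(1)[of k] by auto
  have x0: "?x k \<noteq> 0" "degree (?x k) = k" for k
    by (simp_all add: degree_monom_eq)
  have D: "p m - ?x m = 0 \<or> degree (p m - ?x m) < m"
  proof -
    have "degree (p m - ?x m) \<le> m" "coeff (p m - ?x m) m = 0"
      using p[of m] by (auto intro!: degree_diff_le simp: degree_monom_eq)
    then show ?thesis
      by (metis le_neq_implies_less leading_coeff_0_iff)
  qed
  have top: "\<Lambda> (p m) = \<Lambda> (p m - ?x m) + \<Lambda> (?x m)"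
    using add[of "p m - ?x m" "?x m"] by simp
  have "(\<forall>k<m. \<Lambda> (?x k) = 0) \<and> \<Lambda> (?x m) = 1 \<longleftrightarrow> (\<forall>k<m. \<Lambda> (p k) = 0) \<and> \<Lambda> (p m) = 1"
  proof (intro iffI conjI allI impI; elim conjE)
    assume *: "\<forall>k<m. \<Lambda> (?x k) = 0" "\<Lambda> (?x m) = 1"
    show "\<Lambda> (p k) = 0" if "k < m" for k
      using basis[OF x0 *(1)] p(2) that by simp
    show "\<Lambda> (p m) = 1"
      using basis[OF x0 *(1) D] top * by simp
  next
    assume *: "\<forall>k<m. \<Lambda> (p k) = 0" "\<Lambda> (p m) = 1"
    show "\<Lambda> (?x k) = 0" if "k < m" for k
      using basis[OF p0 p(2) *(1)] x0 that by simp
    show "\<Lambda> (?x m) = 1"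
      using basis[OF p0 p(2) *(1) D] top * by simp
  qed
  then show ?thesis
    by (simp add: \<Lambda>_def m_def poly_monom)
qed

section \<open>Type I vectors as solutions of M c = e_n\<close>

text \<open>The degree bounds hold for every combination, and nontriviality follows from the last
  moment being 1. What remains are the moment conditions, which in the basis \<open>p\<close> are
  the rows of the linear system.\<close>

lemma type_I_combination_iff:
  assumes W: "\<forall>w \<in> set ws. weight w" and L: "length ns = length ws" and n: "sum_list ns \<ge> 1"
    and p: "\<And>k. lead_coeff (p k) = 1" "\<And>k. degree (p k) = k"
  shows "type_I ws ns (combination p ns a) \<longleftrightarrow>
    M_mat p ws ns *\<^sub>v stack_vec ns a = e_last (sum_list ns)"
proof -
  let ?n = "sum_list ns" and ?f = "linear_form ws (combination p ns a)"
  have deg: "combination p ns a ! j = 0 \<or> degree (combination p ns a ! j) < ns ! j"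
    if "j < length ws" for j
    using that L degree_poly_basis_sum[OF p(2)] by (simp add: combination_def)
  have "\<exists>j<length ws. combination p ns a ! j \<noteq> 0"
    if "(LINT x|lebesgue. ?f x * x ^ (?n - 1)) = 1"
  proof (rule ccontr)
    assume "\<not> ?thesis"
    then have "?f x = 0" for x
      by (simp add: linear_form_def)
    with that show False by simp
  qed
  then have "type_I ws ns (combination p ns a) \<longleftrightarrow>
      (\<forall>k<?n - 1. (LINT x|lebesgue. ?f x * x ^ k) = 0) \<and> (LINT x|lebesgue. ?f x * x ^ (?n - 1)) = 1"
    unfolding type_I_def using deg L by (auto simp: combination_def)
  also have "\<dots> \<longleftrightarrow> (\<forall>k<?n - 1. (LINT x|lebesgue. ?f x * poly (p k) x) = 0)
      \<and> (LINT x|lebesgue. ?f x * poly (p (?n - 1)) x) = 1"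
    by (intro moments_iff_basis integrable_poly_linear_form W p)
  also have "\<dots> \<longleftrightarrow> (\<forall>k<?n. (M_mat p ws ns *\<^sub>v stack_vec ns a) $ k = e_last ?n $ k)"
  proof -
    \<comment> \<open>The normalisation is the last row; splitting it off requires n \<ge>
      1.\<close>
    have "(\<forall>k<?n. P k) \<longleftrightarrow> (\<forall>k<?n - 1. P k) \<and> P (?n - 1)" for P
      using n by (cases ?n) (auto simp: less_Suc_eq)
    then show ?thesis
      using n by (simp add: M_mat_mult_stack_vec[OF W L] e_last_def)
  qed
  also have "\<dots> \<longleftrightarrow> M_mat p ws ns *\<^sub>v stack_vec ns a = e_last ?n"
  proof
    assume *: "\<forall>k<?n. (M_mat p ws ns *\<^sub>v stack_vec ns a) $ k = e_last ?n $ k"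
    show "M_mat p ws ns *\<^sub>v stack_vec ns a = e_last ?n"
    proof (rule eq_vecI)
      show "(M_mat p ws ns *\<^sub>v stack_vec ns a) $ k = e_last ?n $ k" if "k < dim_vec (e_last ?n)" for k
        using * that by (simp add: e_last_def)
    qed (simp add: e_last_def M_mat_def)
  qed simp
  finally show ?thesis .
qed

lemma type_I_is_combination:
  assumes "type_I ws ns As" and L: "length ns = length ws"
    and p: "\<And>k. p k \<noteq> 0" "\<And>k. degree (p k) = k"
  obtains a where "As = combination p ns a"
proof -
  have "\<exists>b. As ! j = (\<Sum>k<ns ! j. smult (b k) (p k))" if "j < length ws" for j
    using that assms(1) by (intro poly_basis_expansion p) (auto simp: type_I_def)
  then obtain b where "\<And>j. j < length ws \<Longrightarrow> As ! j = (\<Sum>k<ns ! j. smult (b j k) (p k))"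
    by metis
  then have "As = combination p ns (\<lambda>(j, k). b j k)"
    using assms(1) L by (intro nth_equalityI) (auto simp: combination_def type_I_def)
  then show thesis by (rule that)
qed

text \<open>Uniqueness of basis expansions, applied block by block, fixes the coefficients at the
  stacked pairs.\<close>

lemma combination_inject:
  assumes "combination p ns a = combination p ns b"
    and p: "\<And>k. p k \<noteq> 0" "\<And>k. degree (p k) = k"
  shows "stack_vec ns a = stack_vec ns b"
proof -
  have "a (j, k) = b (j, k)" if "j < length ns" "k < ns ! j" for j k
  proof (rule poly_basis_unique[OF p])
    show "(\<Sum>k<ns ! j. smult (a (j, k)) (p k)) = (\<Sum>k<ns ! j. smult (b (j, k)) (p k))"
      using arg_cong[OF assms(1), of "\<lambda>As. As ! j"] that by (simp add: combination_def)
  qed (use that in simp)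
  then have "\<forall>jk \<in> set (stacked ns). a jk = b jk"
    by (auto simp: set_stacked)
  then show ?thesis
    by (auto simp: stack_vec_def)
qed

text \<open>Adding a kernel vector of M to the coefficients of the type I vector gives another
  solution of M c = e_n, hence another type I vector. Existence supplies the solution to perturb;
  uniqueness forces the kernel vector to vanish.\<close>

lemma det_M_mat_nonzero:
  assumes W: "\<forall>w \<in> set ws. weight w" and L: "length ns = length ws" and n: "sum_list ns \<ge> 1"
    and p: "\<And>k. lead_coeff (p k) = 1" "\<And>k. degree (p k) = k"
    and ex1: "\<exists>!As. type_I ws ns As"
  shows "det (M_mat p ws ns) \<noteq> 0"
proof
  let ?M = "M_mat p ws ns"
  have M: "?M \<in> carrier_mat (sum_list ns) (sum_list ns)"
    by (simp add: M_mat_def)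
  have p0: "p k \<noteq> 0" for k
    using p(1)[of k] by auto
  note iff = type_I_combination_iff[OF W L n p]
  assume "det ?M = 0"
  then obtain v where v: "v \<in> carrier_vec (sum_list ns)" "v \<noteq> 0\<^sub>v (sum_list ns)"
      "?M *\<^sub>v v = 0\<^sub>v (sum_list ns)"
    using det_0_iff_vec_prod_zero_field[OF M] by blast
  obtain As where As: "type_I ws ns As"
    using ex1 by blast
  then obtain a where a: "As = combination p ns a"
    using type_I_is_combination[OF _ L p0 p(2)] by blast
  \<comment> \<open>The perturbed vector must again come from a coefficient system before it can be
    read as a vector of polynomials.\<close>
  obtain b where b: "stack_vec ns a + v = stack_vec ns b"
    using stack_vec_surj v(1) by (metis add_carrier_vec stack_vec_carrier)
  have Ma: "?M *\<^sub>v stack_vec ns a = e_last (sum_list ns)"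
    using As iff a by simp
  have "?M *\<^sub>v stack_vec ns b = e_last (sum_list ns)"
    unfolding b[symmetric] using M v
    by (simp add: mult_add_distrib_mat_vec[OF M] Ma e_last_def)
  then have "combination p ns b = combination p ns a"
    using ex1 As iff a by blast
  then have "stack_vec ns a + v = stack_vec ns a"
    using combination_inject[OF _ p0 p(2)] b by metis
  then have "v $ i = 0" if "i < sum_list ns" for i
    using that v(1) index_add_vec(1)[of i v "stack_vec ns a"] by (auto simp: stack_vec_def)
  then have "v = 0\<^sub>v (sum_list ns)"
    using v(1) by (intro eq_vecI) auto
  with v(2) show False by simp
qed

section \<open>Both formulas for the type I linear form\<close>

theorem theorem3p2:
  fixes ws :: "(real \<Rightarrow> real) list" and ns :: "nat list"
    and p :: "nat \<Rightarrow> real poly" and As :: "real poly list"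
  defines "n \<equiv> sum_list ns"
    and "M \<equiv> M_mat p ws ns"
  assumes "length ws \<ge> 2"
    and "\<forall>w \<in> set ws. weight w"
    and "perfect ws"
    and "length ns = length ws"
    and "n \<ge> 1"
    and "monic_orthogonal (ws ! 0) p"
    and "type_I ws ns As"
  shows "det M \<noteq> 0 \<and>
    (\<forall>x. linear_form ws As x = e_last n \<bullet> (inv_mat (transpose_mat M) *\<^sub>v q_vec p ws ns x) \<and>
         linear_form ws As x =
           - (1 / det M) * det (bordered_mat M (e_last n) (q_vec p ws ns x)))"
proof -
  note W = \<open>\<forall>w \<in> set ws. weight w\<close> and L = \<open>length ns = length ws\<close>
    and n = \<open>n \<ge> 1\<close>[unfolded n_def]
  have p: "lead_coeff (p k) = 1" "degree (p k) = k" for k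
    using \<open>monic_orthogonal (ws ! 0) p\<close> unfolding monic_orthogonal_def by blast+
  have p0: "p k \<noteq> 0" for k
    using p(1)[of k] by auto
  have "sum_list ns \<noteq> 0"
    using n by linarith
  then have "\<exists>!As. type_I ws ns As"
    using \<open>perfect ws\<close> L unfolding perfect_def by blast
  then have det: "det M \<noteq> 0"
    unfolding M_def by (rule det_M_mat_nonzero[OF W L n p])
  obtain a where a: "As = combination p ns a"
    using type_I_is_combination[OF \<open>type_I ws ns As\<close> L p0 p(2)] .
  have e: "e_last n = M *\<^sub>v stack_vec ns a"
    using \<open>type_I ws ns As\<close> type_I_combination_iff[OF W L n p]
    unfolding a M_def n_def by simp
  have M: "M \<in> carrier_mat n n" and c: "stack_vec ns a \<in> carrier_vec n"
    and q: "q_vec p ws ns x \<in> carrier_vec n" for x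
    using L by (simp_all add: M_def n_def M_mat_def q_vec_stacked)
  \<comment> \<open>With e_n replaced by M c, both right-hand sides collapse to c \<bullet> q(x):
    the first by cancelling the inverse transpose, the second by dividing -det M (c \<bullet> q(x))
    by -det M.\<close>
  show ?thesis
    unfolding e a linear_form_combination[OF L]
    using det by (simp add: scalar_prod_inv_mat_transpose[OF M det c q]
        det_bordered_mat_mult[OF M c q])
qed

end
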